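(* Let $k,t$ be integers with $k=t^2\ge 9$, and let $H$ be a subgraph of the star $K_{1,\lceil (k-3)/2\rceil}$ with $|E(H)|\ge 4$. Then $$\operatorname{bi-GM}_{k-2}(K_{1,3}:H)=\begin{cases}4, & t=3;\\ 28, & t=4;\\ 93, & t=5;\\ (2t-1)\binom{t}{3}+\binom{t-3}{3}+3\binom{t-3}{2}, & t\ge 6.\end{cases}$$
   Context: All graphs are finite, simple and without isolated vertices. $K_{m,n}$ is the complete bipartite graph. A $k$-edge-coloring of a graph is a map from its edge set onto $\{1,\dots,k\}$ that is exact, i.e. every one of the $k$ colors is used at least once. An edge-colored graph is rainbow if all its edges have distinct colors and monochromatic if all its edges have the same color. A copy of a graph $F$ in a graph $G$ is a subgraph of $G$ isomorphic to $F$; distinct copies are distinct subgraphs. For non-empty bipartite graphs $G,H$ and a positive integer $k$, the bipartite Gallai-Ramsey number $\operatorname{bgr}_k(G:H)$ is the minimum integer $N$ such that for all $n\ge N$, every (exact) $k$-edge-coloring of $K_{n,n}$ contains a rainbow copy of $G$ or a monochromatic copy of $H$. The bipartite Gallai-Ramsey multiplicity $\operatorname{bi-GM}_k(G:H)$ is the minimum, over all (exact) $k$-edge-colorings of $K_{N,N}$ with $N=\operatorname{bgr}_k(G:H)$, of the total number of rainbow copies of $G$ plus monochromatic copies of $H$.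
   Formalization: In bgr_k(G:H), N ranges only over values for which K_{N,N} has an exact k-edge-coloring; read literally, smaller N qualify vacuously and bi-GM would be a minimum over an empty set. The case t=3 is vacuous, as in the statement itself. *)

theory Defs
  imports Complex_Main
begin

text \<open>A graph is a pair of a vertex set and an edge set, an edge being a two-element set of
  vertices.\<close>

type_synonym 'a graph = "'a set \<times> 'a set set"

abbreviation verts :: "'a graph \<Rightarrow> 'a set" where
  "verts G \<equiv> fst G"

abbreviation edges :: "'a graph \<Rightarrow> 'a set set" where
  "edges G \<equiv> snd G"

text \<open>Finite, simple, and (last conjunct) without isolated vertices.\<close>

definition simple_graph :: "'a graph \<Rightarrow> bool" where
  "simple_graph G \<longleftrightarrow>
     finite (verts G) \<and> (\<forall>e\<in>edges G. e \<subseteq> verts G \<and> card e = 2) \<and> (\<forall>v\<in>verts G. \<exists>e\<in>edges G. v \<in> e)"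

definition subgraph :: "'a graph \<Rightarrow> 'a graph \<Rightarrow> bool" where
  "subgraph F G \<longleftrightarrow> verts F \<subseteq> verts G \<and> edges F \<subseteq> edges G"

definition isomorphic :: "'a graph \<Rightarrow> 'b graph \<Rightarrow> bool" where
  "isomorphic F G \<longleftrightarrow> (\<exists>f. bij_betw f (verts F) (verts G) \<and> (\<lambda>e. f ` e) ` edges F = edges G)"

text \<open>A copy is the subgraph itself, not an embedding, so distinct embeddings with the same image
  are counted once.\<close>

definition copies :: "'a graph \<Rightarrow> 'b graph \<Rightarrow> 'b graph set" where
  "copies F G = {C. subgraph C G \<and> isomorphic F C}"

definition complete_bipartite :: "nat \<Rightarrow> nat \<Rightarrow> (nat + nat) graph" where
  "complete_bipartite m n =
     (Inl ` {..<m} \<union> Inr ` {..<n}, {{Inl i, Inr j} | i j. i < m \<and> j < n})"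

text \<open>A colouring is a total function on sets of vertices; only its values on edges matter.\<close>

definition exact_edge_coloring :: "nat \<Rightarrow> 'a graph \<Rightarrow> ('a set \<Rightarrow> nat) \<Rightarrow> bool" where
  "exact_edge_coloring k G c \<longleftrightarrow> c ` edges G = {1..k}"

definition rainbow :: "('a set \<Rightarrow> nat) \<Rightarrow> 'a graph \<Rightarrow> bool" where
  "rainbow c G \<longleftrightarrow> inj_on c (edges G)"

definition monochromatic :: "('a set \<Rightarrow> nat) \<Rightarrow> 'a graph \<Rightarrow> bool" where
  "monochromatic c G \<longleftrightarrow> (\<forall>e\<in>edges G. \<forall>e'\<in>edges G. c e = c e')"

text \<open>The first conjunct excludes those \<open>N\<close> for which \<open>K\<^sub>N\<^sub>,\<^sub>N\<close> has fewer than \<open>k\<close> edges.  There the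
  requirement on colourings holds vacuously, and without the conjunct such an \<open>N\<close> could be the
  minimum, leaving no colouring over which to minimise in \<open>bi_GM\<close>.\<close>

definition bgr :: "nat \<Rightarrow> 'a graph \<Rightarrow> 'b graph \<Rightarrow> nat" where
  "bgr k G H = (LEAST N.
     (\<exists>c. exact_edge_coloring k (complete_bipartite N N) c) \<and>
     (\<forall>n\<ge>N. \<forall>c. exact_edge_coloring k (complete_bipartite n n) c \<longrightarrow>
        (\<exists>C\<in>copies G (complete_bipartite n n). rainbow c C) \<or>
        (\<exists>C\<in>copies H (complete_bipartite n n). monochromatic c C)))"

definition bi_GM :: "nat \<Rightarrow> 'a graph \<Rightarrow> 'b graph \<Rightarrow> nat" where
  "bi_GM k G H = (let K = complete_bipartite (bgr k G H) (bgr k G H) in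
     LEAST m. \<exists>c. exact_edge_coloring k K c \<and>
       m = card {C \<in> copies G K. rainbow c C} + card {C \<in> copies H K. monochromatic c C})"

end

theory Submission
  imports Defs
begin

text \<open>A colouring of \<open>K\<^sub>n\<^sub>,\<^sub>n\<close> without rainbow \<open>K\<^sub>1\<^sub>,\<^sub>3\<close> shows at most two colours at each vertex, which with
  many colours forces a dominant colour and hence a monochromatic \<open>H\<close>; so the Gallai-Ramsey number
  is the least \<open>N\<close> with \<open>N\<^sup>2 \<ge> t\<^sup>2 - 2\<close>, namely \<open>t\<close>.  On \<open>K\<^sub>t\<^sub>,\<^sub>t\<close> the colouring repeats colours only twice,
  so colour classes have at most three edges, no copy of \<open>H\<close> is monochromatic, and one has to maximise the
  number of non-rainbow \<open>K\<^sub>1\<^sub>,\<^sub>3\<close>.  Each pair of equally coloured edges spoils at most \<open>t - 2\<close> of them;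
  for \<open>t \<ge> 4\<close> the best choice is a class of three edges at one vertex, which spoils \<open>3 (t - 3) + 1\<close>.\<close>

section \<open>Stars, and copies of stars as sets of edges\<close>

definition star :: "'a \<Rightarrow> 'a set \<Rightarrow> 'a graph" where
  "star x A = (insert x A, (\<lambda>a. {x, a}) ` A)"

text \<open>These sets stand in for the copies of a star with \<open>s\<close> edges: for
  \<open>s > 0\<close> a copy is determined by its edges, and counting sets of edges is easier than
  counting pairs.\<close>

definition star_sets :: "'a graph \<Rightarrow> nat \<Rightarrow> 'a set set set" where
  "star_sets K s = {E. E \<subseteq> edges K \<and> card E = s \<and> (\<exists>v. \<forall>e\<in>E. v \<in> e)}"

definition incident :: "'a graph \<Rightarrow> 'a \<Rightarrow> 'a set set" where
  "incident K v = {e \<in> edges K. v \<in> e}"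

lemma inj_on_pair: "inj_on (\<lambda>a. {x, a}) A"
  by (auto simp: inj_on_def doubleton_eq_iff)

lemma card_edges_star [simp]: "card (edges (star x A)) = card A"
  by (simp add: star_def card_image inj_on_pair)

lemma isomorphic_star:
  assumes "finite A" "finite B" "card A = card B" "x \<notin> A" "y \<notin> B"
  shows "isomorphic (star x A) (star y B)"
proof -
  obtain g where g: "bij_betw g A B"
    using assms finite_same_card_bij by blast
  define f where "f = (\<lambda>a. if a = x then y else g a)"
  have fA: "f a = g a" if "a \<in> A" for a
    using that assms by (auto simp: f_def)
  have fx: "f x = y" by (simp add: f_def)
  have "bij_betw f A B"
    using g fA bij_betw_cong by blast
  then have 1: "bij_betw f (insert x A) (insert y B)"
    using assms(4,5) notIn_Un_bij_betw[of x A f B] by (simp add: f_def)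
  have "(\<lambda>e. f ` e) ` (\<lambda>a. {x, a}) ` A = (\<lambda>a. {y, g a}) ` A"
  proof -
    have "f ` {x, a} = {y, g a}" if "a \<in> A" for a
      using fA[OF that] fx by simp
    then show ?thesis unfolding image_image by (rule image_cong[OF refl])
  qed
  also have "\<dots> = (\<lambda>b. {y, b}) ` g ` A" by (simp add: image_image)
  also have "g ` A = B" using g by (simp add: bij_betw_def)
  finally show ?thesis
    unfolding isomorphic_def star_def fst_conv snd_conv using 1 by blast
qed

lemma isomorphic_starD:
  assumes "isomorphic (star x A) C" "x \<notin> A"
  obtains y B where "C = star y B" "y \<notin> B" "card B = card A"
proof -
  obtain f where f: "bij_betw f (insert x A) (verts C)"
    and e: "(\<lambda>e. f ` e) ` (\<lambda>a. {x, a}) ` A = edges C"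
    using assms unfolding isomorphic_def star_def by auto
  have inj: "inj_on f (insert x A)" using f by (simp add: bij_betw_def)
  have "verts C = insert (f x) (f ` A)" using f by (auto simp: bij_betw_def)
  moreover have "edges C = (\<lambda>b. {f x, b}) ` f ` A"
    unfolding e[symmetric] by (simp add: image_image)
  ultimately have "C = star (f x) (f ` A)" by (simp add: star_def prod_eq_iff)
  moreover have "f x \<notin> f ` A" using inj assms(2) by (auto simp: inj_on_def)
  moreover have "card (f ` A) = card A" using inj by (meson card_image inj_on_subset subset_insertI)
  ultimately show thesis using that by blast
qed

lemma star_set_eq:
  assumes E: "\<forall>e\<in>E. card e = 2 \<and> v \<in> e"
  shows "E = (\<lambda>a. {v, a}) ` (\<Union>E - {v})"
proof (intro equalityI subsetI)
  fix e assume e: "e \<in> E"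
  with E have "card e = 2" "v \<in> e" by auto
  then obtain a where a: "e = {v, a}" "a \<noteq> v"
    by (auto simp: card_2_iff)
  with e show "e \<in> (\<lambda>a. {v, a}) ` (\<Union>E - {v})" by blast
next
  fix e assume "e \<in> (\<lambda>a. {v, a}) ` (\<Union>E - {v})"
  then obtain a e' where a: "e = {v, a}" "a \<noteq> v" "a \<in> e'" "e' \<in> E" by auto
  then have "card e' = 2" "v \<in> e'" using E by auto
  then have "e' = {v, a}" using a by (auto simp: card_2_iff)
  then show "e \<in> E" using a by simp
qed

text \<open>A star with at least one edge is spanned by its edges, so a copy can be recovered from
  its edge set. Nonemptiness of \<open>A\<close> matters: all one-vertex copies would share the
  empty edge set.\<close>

lemma bij_betw_copies_star:
  assumes K: "simple_graph K" and A: "finite A" "A \<noteq> {}" "x \<notin> A"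
  shows "bij_betw edges (copies (star x A) K) (star_sets K (card A))"
proof (rule bij_betw_imageI)
  have un: "verts C = \<Union>(edges C)" if C: "C \<in> copies (star x A) K" for C
  proof -
    have "isomorphic (star x A) C" using C by (simp add: copies_def)
    then obtain y B where yB: "C = star y B" "card B = card A"
      by (rule isomorphic_starD[OF _ A(3)])
    then have "B \<noteq> {}" using A by (metis card.empty card_0_eq)
    then show ?thesis using yB by (auto simp: star_def)
  qed
  show "inj_on edges (copies (star x A) K)"
  proof (rule inj_onI)
    fix C D assume "C \<in> copies (star x A) K" "D \<in> copies (star x A) K" "edges C = edges D"
    then show "C = D" using un[of C] un[of D] by (simp add: prod_eq_iff)
  qed
  show "edges ` copies (star x A) K = star_sets K (card A)"
  proof (intro equalityI subsetI)
    fix E assume "E \<in> edges ` copies (star x A) K"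
    then obtain C where C: "C \<in> copies (star x A) K" "E = edges C" by auto
    have "isomorphic (star x A) C" using C by (simp add: copies_def)
    then obtain y B where yB: "C = star y B" "card B = card A"
      by (rule isomorphic_starD[OF _ A(3)])
    have "E \<subseteq> edges K" using C by (auto simp: copies_def subgraph_def)
    moreover have "card E = card A" using C yB by simp
    moreover have "\<forall>e\<in>E. y \<in> e" using C yB by (auto simp: star_def)
    ultimately show "E \<in> star_sets K (card A)" by (auto simp: star_sets_def)
  next
    fix E assume "E \<in> star_sets K (card A)"
    then obtain v where E: "E \<subseteq> edges K" "card E = card A" "\<forall>e\<in>E. v \<in> e"
      by (auto simp: star_sets_def)
    define B where "B = \<Union>E - {v}"
    have EB: "E = (\<lambda>a. {v, a}) ` B"
      unfolding B_def using E K by (intro star_set_eq) (auto simp: simple_graph_def)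
    then have cB: "card B = card A" using E(2) card_image[OF inj_on_pair, of v B] by simp
    then have "finite B" "B \<noteq> {}" using A by (metis card_gt_0_iff)+
    moreover have "v \<notin> B" by (simp add: B_def)
    ultimately have "isomorphic (star x A) (star v B)"
      using isomorphic_star A cB by metis
    moreover have "subgraph (star v B) K"
    proof -
      have "\<Union>E \<subseteq> verts K" using E(1) K by (auto simp: simple_graph_def)
      moreover have "insert v B = \<Union>E" using EB \<open>B \<noteq> {}\<close> by auto
      ultimately show ?thesis using E(1) EB by (simp add: subgraph_def star_def)
    qed
    ultimately have "star v B \<in> copies (star x A) K" by (simp add: copies_def)
    moreover have "edges (star v B) = E" using EB by (simp add: star_def)
    ultimately show "E \<in> edges ` copies (star x A) K" by blast
  qed
qed

lemma complete_bipartite_1: "complete_bipartite 1 s = star (Inl 0) (Inr ` {..<s})"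
  by (auto simp: complete_bipartite_def star_def)

lemma bij_betw_copies_K13:
  assumes "simple_graph K"
  shows "bij_betw edges (copies (complete_bipartite 1 3) K) (star_sets K 3)"
proof -
  let ?A = "Inr ` {..<3::nat} :: (nat + nat) set"
  have "Inl 0 \<notin> ?A" "?A \<noteq> {}" "finite ?A" by (auto simp: lessThan_empty_iff)
  then have "bij_betw edges (copies (star (Inl 0) ?A) K) (star_sets K (card ?A))"
    using assms by (intro bij_betw_copies_star)
  moreover have "card ?A = 3" by (simp add: card_image)
  ultimately show ?thesis by (simp only: complete_bipartite_1)
qed

text \<open>By injectivity of the isomorphism, the preimage \<open>x\<close> of the centre
  \<open>Inl 0\<close> lies on every edge of \<open>H\<close>; as \<open>H\<close> has no isolated
  vertices, nothing else is left. The edges map injectively to edges of the big star, which bounds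
  \<open>card A\<close>.\<close>

lemma subgraph_of_star_is_star:
  assumes H: "simple_graph H" and S: "subgraph S (complete_bipartite 1 s)" "isomorphic H S"
    and ne: "edges H \<noteq> {}"
  obtains x A where "H = star x A" "finite A" "x \<notin> A" "card A \<le> s"
proof -
  obtain f where f: "bij_betw f (verts H) (verts S)" and e: "(\<lambda>e. f ` e) ` edges H = edges S"
    using S by (auto simp: isomorphic_def)
  have inj: "inj_on f (verts H)" using f by (simp add: bij_betw_def)
  have sub: "\<And>e. e \<in> edges H \<Longrightarrow> e \<subseteq> verts H" and c2: "\<And>e. e \<in> edges H \<Longrightarrow> card e = 2"
    using H by (auto simp: simple_graph_def)
  have eS: "edges S \<subseteq> edges (complete_bipartite 1 s)" using S by (simp add: subgraph_def)
  have ctr: "Inl 0 \<in> f ` e" if "e \<in> edges H" for e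
  proof -
    have "f ` e \<in> edges S" unfolding e[symmetric] using that by (rule imageI)
    then have "f ` e \<in> edges (complete_bipartite 1 s)" using eS by blast
    then show ?thesis unfolding complete_bipartite_1 star_def by auto
  qed
  obtain x where x: "x \<in> verts H" "f x = Inl 0"
  proof -
    from ne obtain e0 where e0: "e0 \<in> edges H" by auto
    from ctr[OF e0] obtain x where "x \<in> e0" "Inl 0 = f x" by blast
    then show thesis using that sub[OF e0] by auto
  qed
  have xe: "x \<in> e" if e: "e \<in> edges H" for e
  proof -
    obtain y where y: "y \<in> e" "f y = Inl 0" using ctr[OF e] by force
    have "y = x" by (rule inj_onD[OF inj]) (use y x sub[OF e] in auto)
    then show ?thesis using y by simp
  qed
  define A where "A = verts H - {x}"
  have un: "verts H = \<Union>(edges H)" using H by (fastforce simp: simple_graph_def)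
  have "edges H = (\<lambda>a. {x, a}) ` A"
    unfolding A_def un using c2 xe by (intro star_set_eq) auto
  moreover have "verts H = insert x A" using x by (auto simp: A_def)
  ultimately have HA: "H = star x A" by (simp add: star_def prod_eq_iff)
  have "card A = card (edges H)" using HA by simp
  also have "\<dots> = card (edges S)"
  proof -
    have "inj_on (\<lambda>e. f ` e) (edges H)"
      using inj sub by (meson inj_on_image_eq_iff inj_onI)
    then show ?thesis unfolding e[symmetric] by (simp add: card_image)
  qed
  also have "\<dots> \<le> card (edges (complete_bipartite 1 s))"
    by (rule card_mono[OF _ eS]) (simp add: complete_bipartite_1[unfolded One_nat_def] star_def)
  also have "\<dots> = s" unfolding complete_bipartite_1 by (simp add: card_image)
  finally have "card A \<le> s" .
  moreover have "finite A" using H by (simp add: A_def simple_graph_def)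
  moreover have "x \<notin> A" by (simp add: A_def)
  ultimately show thesis using that[OF HA] by blast
qed

section \<open>Edges, degrees and three-edge stars of the complete bipartite graph\<close>

lemma edges_complete_bipartite:
  "edges (complete_bipartite m n) = (\<lambda>(i, j). {Inl i, Inr j}) ` ({..<m} \<times> {..<n})"
  by (auto simp: complete_bipartite_def)

lemma simple_complete_bipartite: "n > 0 \<Longrightarrow> simple_graph (complete_bipartite n n)"
  by (auto simp: simple_graph_def complete_bipartite_def)

lemma card_edges_complete_bipartite: "card (edges (complete_bipartite n n)) = n\<^sup>2"
proof -
  have "inj_on (\<lambda>(i, j). {Inl i, Inr j}) ({..<n} \<times> {..<n})"
    by (auto simp: inj_on_def doubleton_eq_iff)
  then show ?thesis
    by (simp add: edges_complete_bipartite card_image power2_eq_square)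
qed

lemma finite_edges_complete_bipartite [simp]: "finite (edges (complete_bipartite n n))"
  by (simp add: edges_complete_bipartite)

lemma incident_Inl:
  "i < n \<Longrightarrow> incident (complete_bipartite n n) (Inl i) = (\<lambda>j. {Inl i, Inr j}) ` {..<n}"
  by (auto simp: incident_def complete_bipartite_def)

lemma incident_Inr:
  "j < n \<Longrightarrow> incident (complete_bipartite n n) (Inr j) = (\<lambda>i. {Inl i, Inr j}) ` {..<n}"
  by (auto simp: incident_def complete_bipartite_def)

lemma card_incident:
  assumes "v \<in> verts (complete_bipartite n n)"
  shows "card (incident (complete_bipartite n n) v) = n"
proof -
  consider i where "v = Inl i" "i < n" | j where "v = Inr j" "j < n"
    using assms by (auto simp: complete_bipartite_def)
  then show ?thesis
  proof cases
    case (1 i)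
    have "inj_on (\<lambda>j. {Inl i, Inr j}) {..<n}" by (auto simp: inj_on_def doubleton_eq_iff)
    then show ?thesis using 1 by (simp add: incident_Inl card_image)
  next
    case (2 j)
    have "inj_on (\<lambda>i. {Inl i, Inr j}) {..<n}" by (auto simp: inj_on_def doubleton_eq_iff)
    then show ?thesis using 2 by (simp add: incident_Inr card_image)
  qed
qed

lemma card_verts: "card (verts (complete_bipartite n n)) = 2 * n"
proof -
  have "card (Inl ` {..<n} \<union> Inr ` {..<n} :: (nat + nat) set) = 2 * n"
    by (subst card_Un_disjoint) (auto simp: card_image)
  then show ?thesis by (simp add: complete_bipartite_def)
qed

text \<open>Used to see that a star with at least two edges has only one possible centre.\<close>

lemma simple_two_common:
  assumes "simple_graph K" "e \<in> edges K" "f \<in> edges K" "e \<noteq> f"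
    and "v \<in> e" "v \<in> f" "w \<in> e" "w \<in> f"
  shows "v = w"
proof (rule ccontr)
  assume "v \<noteq> w"
  moreover have "card e = 2" "card f = 2" using assms by (auto simp: simple_graph_def)
  ultimately have "e = {v, w}" "f = {v, w}" using assms by (auto simp: card_2_iff)
  then show False using assms by simp
qed

text \<open>Sorts the stars by their centre. Since \<open>s > 0\<close>, some edge passes through
  the centre, which is therefore a vertex of \<open>K\<close>.\<close>

lemma star_sets_eq_UN:
  assumes K: "simple_graph K" and s: "s > 0"
  shows "star_sets K s = (\<Union>v\<in>verts K. {E. E \<subseteq> incident K v \<and> card E = s})"
proof (intro equalityI subsetI)
  fix E assume "E \<in> star_sets K s"
  then obtain v where v: "E \<subseteq> edges K" "card E = s" "\<forall>e\<in>E. v \<in> e"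
    by (auto simp: star_sets_def)
  moreover have "E \<noteq> {}" using v s by auto
  ultimately have "v \<in> verts K" using K by (fastforce simp: simple_graph_def)
  then show "E \<in> (\<Union>v\<in>verts K. {E. E \<subseteq> incident K v \<and> card E = s})"
    using v by (auto simp: incident_def)
qed (auto simp: star_sets_def incident_def)

text \<open>The families for different centres are disjoint because three edges have at most one
  common vertex, and each of the \<open>2 * n\<close> vertices has degree \<open>n\<close>.\<close>

lemma card_star_sets:
  assumes "n > 0"
  shows "card (star_sets (complete_bipartite n n) 3) = 2 * n * (n choose 3)"
proof -
  let ?K = "complete_bipartite n n"
  have K: "simple_graph ?K" using assms by (rule simple_complete_bipartite)
  have fin: "finite (incident ?K v)" for v by (simp add: incident_def)
  have "card (star_sets ?K 3) = (\<Sum>v\<in>verts ?K. card {E. E \<subseteq> incident ?K v \<and> card E = 3})"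
    unfolding star_sets_eq_UN[OF K zero_less_numeral]
  proof (rule card_UN_disjoint)
    show "finite (verts ?K)" using K by (simp add: simple_graph_def)
    show "\<forall>v\<in>verts ?K. finite {E. E \<subseteq> incident ?K v \<and> card E = 3}" using fin by simp
    have False if "v \<noteq> w" "E \<subseteq> incident ?K v" "E \<subseteq> incident ?K w" "card E = 3" for v w E
    proof -
      obtain e f where "e \<in> E" "f \<in> E" "e \<noteq> f"
        using \<open>card E = 3\<close> by (auto simp: card_3_iff)
      then show False using simple_two_common[OF K, of e f v w] that by (auto simp: incident_def)
    qed
    then show "\<forall>i\<in>verts ?K. \<forall>j\<in>verts ?K. i \<noteq> j \<longrightarrow>
        {E. E \<subseteq> incident ?K i \<and> card E = 3} \<inter> {E. E \<subseteq> incident ?K j \<and> card E = 3} = {}"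
      by blast
  qed
  also have "\<dots> = (\<Sum>v\<in>verts ?K. n choose 3)"
    using fin by (intro sum.cong) (auto simp: n_subsets card_incident)
  finally show ?thesis by (simp add: card_verts)
qed

section \<open>Three-edge stars that are not rainbow\<close>

text \<open>Such a triple is either \<open>T\<close> itself or arises from \<open>T\<close> by
  exchanging one of its three elements \<open>y\<close> for one of the \<open>card S - 3\<close>
  elements \<open>x\<close> outside.\<close>

lemma card_triples_meeting_triple:
  assumes S: "finite S" "T \<subseteq> S" "card T = 3"
  shows "card {E. E \<subseteq> S \<and> card E = 3 \<and> card (E \<inter> T) \<ge> 2} = 3 * (card S - 3) + 1"
proof -
  let ?g = "\<lambda>(y, x). insert x (T - {y})"
  have fT: "finite T" using S finite_subset by blast
  have inj: "inj_on ?g (T \<times> (S - T))"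
  proof (rule inj_onI, clarify)
    fix y x y' x' assume a: "y \<in> T" "y' \<in> T" "x \<notin> T" "x' \<notin> T"
      and eq: "insert x (T - {y}) = insert x' (T - {y'})"
    \<comment> \<open>Both the inserted and the removed element can be read off from the resulting
      set by taking differences with \<open>T\<close>.\<close>
    have "{x} = insert x (T - {y}) - T" "{x'} = insert x' (T - {y'}) - T"
      "{y} = T - insert x (T - {y})" "{y'} = T - insert x' (T - {y'})"
      using a by auto
    then show "y = y' \<and> x = x'" using eq by (metis the_elem_eq)
  qed
  have "{E. E \<subseteq> S \<and> card E = 3 \<and> card (E \<inter> T) \<ge> 2} = insert T (?g ` (T \<times> (S - T)))"
  proof (intro equalityI subsetI)
    fix E assume E: "E \<in> {E. E \<subseteq> S \<and> card E = 3 \<and> card (E \<inter> T) \<ge> 2}"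
    then have fE: "finite E" using S finite_subset by blast
    have split: "card E = card (E \<inter> T) + card (E - T)"
      using fE by (metis card_Int_Diff)
    have splitT: "card T = card (E \<inter> T) + card (T - E)"
      using fT by (metis card_Int_Diff inf_commute)
    show "E \<in> insert T (?g ` (T \<times> (S - T)))"
    proof (cases "card (E \<inter> T) = 3")
      case True
      then have "E \<inter> T = T" using S fT by (intro card_subset_eq) auto
      moreover have "E \<inter> T = E" using True E fE by (intro card_subset_eq) auto
      ultimately show ?thesis by simp
    next
      case False
      then have "card (E - T) = 1" "card (T - E) = 1" using E S split splitT by auto
      then obtain x y where "E - T = {x}" "T - E = {y}" by (auto simp: card_1_singleton_iff)
      then have "E = ?g (y, x)" "y \<in> T" "x \<in> S - T" using E by auto
      then show ?thesis by blast
    qed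
  next
    fix E assume "E \<in> insert T (?g ` (T \<times> (S - T)))"
    then consider "E = T" | y x where "y \<in> T" "x \<in> S" "x \<notin> T" "E = insert x (T - {y})" by auto
    then show "E \<in> {E. E \<subseteq> S \<and> card E = 3 \<and> card (E \<inter> T) \<ge> 2}"
    proof cases
      case 2
      then have "E \<inter> T = T - {y}" by auto
      then have "card (E \<inter> T) = 2" using 2 S fT by simp
      moreover have "card E = 3" using 2 S fT by simp
      ultimately show ?thesis using 2 S by auto
    qed (use S in auto)
  qed
  moreover have "T \<notin> ?g ` (T \<times> (S - T))" by auto
  moreover have "card (?g ` (T \<times> (S - T))) = 3 * (card S - 3)"
    using inj S fT by (simp add: card_image card_cartesian_product card_Diff_subset)
  ultimately show ?thesis using S fT by simp
qed

text \<open>If \<open>e\<close> and \<open>f\<close> lie in a common star at all, they fix its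
  centre \<open>v\<close>, and the third edge is one of the \<open>n - 2\<close> remaining edges at
  \<open>v\<close>.\<close>

lemma card_star_sets_pair:
  assumes n: "n > 0" and ef: "e \<noteq> f"
  shows "card {E \<in> star_sets (complete_bipartite n n) 3. e \<in> E \<and> f \<in> E} \<le> n - 2"
proof (cases "{E \<in> star_sets (complete_bipartite n n) 3. e \<in> E \<and> f \<in> E} = {}")
  case True
  then show ?thesis by (simp only: card.empty)
next
  case False
  let ?K = "complete_bipartite n n"
  have K: "simple_graph ?K" using n by (rule simple_complete_bipartite)
  have fin: "finite (incident ?K v)" for v by (simp add: incident_def)
  from False obtain E v where E: "v \<in> verts ?K" "E \<subseteq> incident ?K v" "e \<in> E" "f \<in> E"
    unfolding star_sets_eq_UN[OF K zero_less_numeral] by auto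
  have "{E \<in> star_sets ?K 3. e \<in> E \<and> f \<in> E} \<subseteq> (\<lambda>x. {e, f, x}) ` (incident ?K v - {e, f})"
  proof
    fix E' assume "E' \<in> {E \<in> star_sets ?K 3. e \<in> E \<and> f \<in> E}"
    then obtain w where w: "w \<in> verts ?K" "E' \<subseteq> incident ?K w" "card E' = 3" "e \<in> E'" "f \<in> E'"
      unfolding star_sets_eq_UN[OF K zero_less_numeral] by auto
    have wv: "w = v" using simple_two_common[OF K, of e f w v] E w ef by (auto simp: incident_def)
    have "card (E' - {e, f}) = 1" using w ef by (simp add: card_Diff_subset)
    then obtain x where "E' - {e, f} = {x}" by (auto simp: card_1_singleton_iff)
    then have "E' = {e, f, x}" "x \<in> E'" "x \<notin> {e, f}" using w(4,5) by blast+
    then have "E' = {e, f, x}" "x \<in> incident ?K v - {e, f}" using w(2) wv by blast+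
    then show "E' \<in> (\<lambda>x. {e, f, x}) ` (incident ?K v - {e, f})" by blast
  qed
  then have "card {E \<in> star_sets ?K 3. e \<in> E \<and> f \<in> E} \<le> card (incident ?K v - {e, f})"
    using fin by (meson finite_Diff surj_card_le)
  also have "\<dots> = n - 2"
    using E ef card_incident[OF E(1)] by (subst card_Diff_subset) auto
  finally show ?thesis .
qed

lemma finite_star_sets [simp]: "finite (star_sets (complete_bipartite n n) s)"
  by (rule finite_subset[of _ "Pow (edges (complete_bipartite n n))"]) (auto simp: star_sets_def)

text \<open>A union bound, for the cases in which only two equally coloured pairs can occur inside a
  star.\<close>

lemma card_nonrainbow_le_if_two_pairs:
  assumes n: "n > 0" and ne: "a \<noteq> a'" "b \<noteq> b'"
    and bad: "\<And>E. E \<in> star_sets (complete_bipartite n n) 3 \<Longrightarrow> \<not> inj_on c E \<Longrightarrow>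
      {a, a'} \<subseteq> E \<or> {b, b'} \<subseteq> E"
  shows "card {E \<in> star_sets (complete_bipartite n n) 3. \<not> inj_on c E} \<le> 2 * (n - 2)"
proof -
  let ?S = "star_sets (complete_bipartite n n) 3"
  have "{E \<in> ?S. \<not> inj_on c E} \<subseteq> {E \<in> ?S. a \<in> E \<and> a' \<in> E} \<union> {E \<in> ?S. b \<in> E \<and> b' \<in> E}"
    using bad by auto
  then have "card {E \<in> ?S. \<not> inj_on c E}
      \<le> card ({E \<in> ?S. a \<in> E \<and> a' \<in> E} \<union> {E \<in> ?S. b \<in> E \<and> b' \<in> E})"
    by (intro card_mono) auto
  also have "\<dots> \<le> card {E \<in> ?S. a \<in> E \<and> a' \<in> E} + card {E \<in> ?S. b \<in> E \<and> b' \<in> E}"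
    by (rule card_Un_le)
  also have "\<dots> \<le> 2 * (n - 2)"
    using card_star_sets_pair[OF n ne(1)] card_star_sets_pair[OF n ne(2)] by linarith
  finally show ?thesis .
qed

text \<open>Keep one representative \<open>R\<close> of each value; two elements \<open>d\<close>,
  \<open>d'\<close> are left over, and \<open>m\<close>, \<open>m'\<close> are the representatives
  sharing their values. As \<open>c\<close> is injective on \<open>R\<close>, every collision
  involves \<open>d\<close> or \<open>d'\<close>. The case \<open>m = m'\<close> is allowed and is
  that of a single value taken three times.\<close>

lemma two_repeated_values:
  assumes fin: "finite X" and card: "card X = card (c ` X) + 2"
  obtains d d' m m' where "d \<noteq> d'" "{d, d', m, m'} \<subseteq> X" "m \<notin> {d, d'}" "m' \<notin> {d, d'}"
    "c m = c d" "c m' = c d'"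
    "\<And>e f. e \<in> X \<Longrightarrow> f \<in> X \<Longrightarrow> e \<noteq> f \<Longrightarrow> c e = c f \<Longrightarrow>
      {e, f} = {d, m} \<or> {e, f} = {d', m'} \<or> {e, f} = {d, d'}"
proof -
  obtain R where R: "R \<subseteq> X" "inj_on c R" "c ` X = c ` R"
    using subset_image_inj[of "c ` X" c X] by auto
  have "card R = card (c ` X)" using R by (simp add: card_image)
  then have "card (X - R) = 2" using R(1) card fin by (simp add: card_Diff_subset finite_subset)
  then obtain d d' where d: "X - R = {d, d'}" "d \<noteq> d'" by (auto simp: card_2_iff)
  have dX: "d \<in> X" "d' \<in> X" using d by auto
  obtain m where m: "m \<in> R" "c m = c d" using R(3) dX by (metis imageE imageI)
  obtain m' where m': "m' \<in> R" "c m' = c d'" using R(3) dX by (metis imageE imageI)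
  show thesis
  proof (rule that)
    show "d \<noteq> d'" by fact
    show "{d, d', m, m'} \<subseteq> X" using dX m m' R by auto
    show "m \<notin> {d, d'}" "m' \<notin> {d, d'}" using d m m' by auto
    show "c m = c d" "c m' = c d'" by fact+
    fix e f assume ef: "e \<in> X" "f \<in> X" "e \<noteq> f" "c e = c f"
    have mate: "{e, f} = {d, m} \<or> {e, f} = {d', m'} \<or> {e, f} = {d, d'}"
      if e: "e = d \<or> e = d'" and f: "f \<in> X" "e \<noteq> f" "c e = c f" for e f
    proof (cases "f \<in> R")
      case True
      have "f = m" if "e = d" using True that f(3) m R(2) by (simp add: inj_on_eq_iff)
      moreover have "f = m'" if "e = d'" using True that f(3) m' R(2) by (simp add: inj_on_eq_iff)
      ultimately show ?thesis using e by blast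
    next
      case False
      then have "f = d \<or> f = d'" using f(1) d by auto
      then show ?thesis using e f(2) by blast
    qed
    have "\<not> (e \<in> R \<and> f \<in> R)" using ef R by (auto dest: inj_onD)
    then consider "e = d \<or> e = d'" | "f = d \<or> f = d'" using ef d by blast
    then show "{e, f} = {d, m} \<or> {e, f} = {d', m'} \<or> {e, f} = {d, d'}"
    proof cases
      case 1
      then show ?thesis using mate ef by blast
    next
      case 2
      then have "{f, e} = {d, m} \<or> {f, e} = {d', m'} \<or> {f, e} = {d, d'}"
        using mate[of f e] ef by simp
      then show ?thesis by (simp only: insert_commute[of f e])
    qed
  qed
qed

text \<open>Two missing colours mean either two colour classes of size two or one of size three. In
  the first case two pairs do the spoiling. In the second, three edges without a common vertex
  include a disjoint pair, which lies in no star, so again two pairs remain; three edges at one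
  vertex give the extremal value.\<close>

lemma card_nonrainbow_le:
  assumes n: "n \<ge> 4" and c: "exact_edge_coloring (n\<^sup>2 - 2) (complete_bipartite n n) c"
  shows "card {E \<in> star_sets (complete_bipartite n n) 3. \<not> inj_on c E} \<le> 3 * (n - 3) + 1"
proof -
  let ?K = "complete_bipartite n n"
  let ?N = "{E \<in> star_sets ?K 3. \<not> inj_on c E}"
  have n0: "n > 0" using n by simp
  have K: "simple_graph ?K" using n0 by (rule simple_complete_bipartite)
  \<comment> \<open>The bound for two pairs is dominated by the extremal value exactly from
    \<open>n = 4\<close> on, where both are equal.\<close>
  have le: "2 * (n - 2) \<le> 3 * (n - 3) + 1" using n by linarith
  have "n\<^sup>2 \<ge> 2" using n by (simp add: power2_eq_square le_trans[OF _ mult_le_mono[OF n n]])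
  then have "card (edges ?K) = card (c ` edges ?K) + 2"
    using c by (simp add: exact_edge_coloring_def card_edges_complete_bipartite)
  then obtain d d' m m' where d: "d \<noteq> d'" "{d, d', m, m'} \<subseteq> edges ?K" "m \<notin> {d, d'}" "m' \<notin> {d, d'}"
    and m: "c m = c d" "c m' = c d'"
    and pairs: "\<And>e f. e \<in> edges ?K \<Longrightarrow> f \<in> edges ?K \<Longrightarrow> e \<noteq> f \<Longrightarrow> c e = c f \<Longrightarrow>
      {e, f} = {d, m} \<or> {e, f} = {d', m'} \<or> {e, f} = {d, d'}"
    by (rule two_repeated_values[OF finite_edges_complete_bipartite]) (rule that)
  \<comment> \<open>The equality \<open>c e = c f\<close> is retained, since it excludes the pair
    \<open>{d, d'}\<close> when \<open>d\<close> and \<open>d'\<close> have different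
    colours.\<close>
  have bad: "\<exists>e f. e \<in> E \<and> f \<in> E \<and> e \<noteq> f \<and> c e = c f \<and>
      ({e, f} = {d, m} \<or> {e, f} = {d', m'} \<or> {e, f} = {d, d'})"
    if E: "E \<in> star_sets ?K 3" "\<not> inj_on c E" for E
  proof -
    obtain e f where ef: "e \<in> E" "f \<in> E" "e \<noteq> f" "c e = c f" using E by (auto simp: inj_on_def)
    have "e \<in> edges ?K" "f \<in> edges ?K" using E ef by (auto simp: star_sets_def)
    from pairs[OF this ef(3,4)] show ?thesis
      by (intro exI[of _ e] exI[of _ f] conjI ef)
  qed
  have sub: "{d, m} \<subseteq> E \<or> {d', m'} \<subseteq> E \<or> {d, d'} \<subseteq> E" if E: "E \<in> star_sets ?K 3" "\<not> inj_on c E" for E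
  proof -
    obtain e f where "e \<in> E" "f \<in> E" and ef: "{e, f} = {d, m} \<or> {e, f} = {d', m'} \<or> {e, f} = {d, d'}"
      using bad[OF E] by (elim exE conjE)
    then have "{e, f} \<subseteq> E" by simp
    with ef show ?thesis by metis
  qed
  have ne: "d \<noteq> m" "d' \<noteq> m'" "d \<noteq> d'" using d by auto
  have bound: ?thesis if "a \<noteq> a'" "b \<noteq> b'"
    "\<And>E. E \<in> star_sets ?K 3 \<Longrightarrow> \<not> inj_on c E \<Longrightarrow> {a, a'} \<subseteq> E \<or> {b, b'} \<subseteq> E" for a a' b b'
    by (rule order_trans[OF card_nonrainbow_le_if_two_pairs[OF n0 that(1,2)] le]) (rule that(3))
  show ?thesis
  proof (cases "c d = c d'")
    case False
    have *: "{d, m} \<subseteq> E \<or> {d', m'} \<subseteq> E" if E: "E \<in> star_sets ?K 3" "\<not> inj_on c E" for E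
    proof -
      obtain e f where "e \<in> E" "f \<in> E" and c: "c e = c f"
        and ef: "{e, f} = {d, m} \<or> {e, f} = {d', m'} \<or> {e, f} = {d, d'}"
        using bad[OF E] by (elim exE conjE)
      then have "{e, f} \<subseteq> E" by simp
      moreover have "{e, f} \<noteq> {d, d'}" using False c by (auto simp: doubleton_eq_iff)
      ultimately show ?thesis using ef by metis
    qed
    show ?thesis by (rule bound[OF ne(1,2)]) (rule *)
  next
    case True
    \<comment> \<open>Otherwise \<open>m\<close> and \<open>m'\<close> would be an equally coloured
      pair avoiding both \<open>d\<close> and \<open>d'\<close>, but each of the three possible
      pairs contains one of them.\<close>
    have mm: "m' = m"
    proof (rule ccontr)
      assume "m' \<noteq> m"
      then have "{m, m'} = {d, m} \<or> {m, m'} = {d', m'} \<or> {m, m'} = {d, d'}"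
        using pairs[of m m'] d(2) m True by simp
      then have "d \<in> {m, m'} \<or> d' \<in> {m, m'}" by (metis insertCI)
      then show False using d(3,4) by auto
    qed
    let ?T = "{d, d', m}"
    \<comment> \<open>A disjoint pair drops out of the three, and the two-pair bound applies to the
      other two.\<close>
    have noncentral: ?thesis if miss: "\<not> (\<exists>v. v \<in> p \<and> v \<in> q)" "{p, q} = {d, m} \<or> {p, q} = {d', m'} \<or> {p, q} = {d, d'}" for p q
    proof -
      have npq: "\<not> {p, q} \<subseteq> E" if "E \<in> star_sets ?K 3" for E
        using that miss(1) by (auto simp: star_sets_def)
      show ?thesis
        using miss(2)
      proof (elim disjE)
        assume eq: "{p, q} = {d, m}"
        have *: "{d', m'} \<subseteq> E \<or> {d, d'} \<subseteq> E" if "E \<in> star_sets ?K 3" "\<not> inj_on c E" for E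
          using sub[OF that] npq[OF that(1)] unfolding eq by blast
        show ?thesis by (rule bound[OF ne(2,3)]) (rule *)
      next
        assume eq: "{p, q} = {d', m'}"
        have *: "{d, m} \<subseteq> E \<or> {d, d'} \<subseteq> E" if "E \<in> star_sets ?K 3" "\<not> inj_on c E" for E
          using sub[OF that] npq[OF that(1)] unfolding eq by blast
        show ?thesis by (rule bound[OF ne(1,3)]) (rule *)
      next
        assume eq: "{p, q} = {d, d'}"
        have *: "{d, m} \<subseteq> E \<or> {d', m'} \<subseteq> E" if "E \<in> star_sets ?K 3" "\<not> inj_on c E" for E
          using sub[OF that] npq[OF that(1)] unfolding eq by blast
        show ?thesis by (rule bound[OF ne(1,2)]) (rule *)
      qed
    qed
    show ?thesis
    proof (cases "\<exists>v. v \<in> d \<and> v \<in> d' \<and> v \<in> m")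
      case False
      text \<open>In a bipartite graph three pairwise adjacent edges have a common vertex.\<close>
      have "\<exists>p q. {p, q} \<subseteq> ?T \<and> p \<noteq> q \<and> \<not> (\<exists>v. v \<in> p \<and> v \<in> q)"
      proof (rule ccontr)
        assume "\<not> ?thesis"
        then have "\<exists>v. v \<in> p \<and> v \<in> q" if "p \<in> ?T" "q \<in> ?T" "p \<noteq> q" for p q
          using that by blast
        from this[of d d'] this[of d m] this[of d' m]
        have "\<exists>v. v \<in> d \<and> v \<in> d'" "\<exists>v. v \<in> d \<and> v \<in> m" "\<exists>v. v \<in> d' \<and> v \<in> m"
          using ne d(3) by simp_all
        moreover obtain i j i' j' i'' j'' where
          "d = {Inl i, Inr j}" "d' = {Inl i', Inr j'}" "m = {Inl i'', Inr j''}"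
          using d(2) by (auto simp: edges_complete_bipartite)
        ultimately show False using False by auto
      qed
      then obtain p q where pq: "{p, q} \<subseteq> ?T" "p \<noteq> q" "\<not> (\<exists>v. v \<in> p \<and> v \<in> q)" by blast
      then have "p = d \<or> p = d' \<or> p = m" "q = d \<or> q = d' \<or> q = m" by simp_all
      then have "{p, q} = {d, m} \<or> {p, q} = {d', m'} \<or> {p, q} = {d, d'}"
        using pq(2) mm by (elim disjE) (simp_all add: insert_commute)
      with pq(3) show ?thesis by (rule noncentral)
    next
      case True
      then obtain v where v: "v \<in> d" "v \<in> d'" "v \<in> m" by blast
      have "d \<in> edges ?K" using d(2) by simp
      then have vK: "v \<in> verts ?K" using K v(1) by (auto simp: simple_graph_def)
      have T: "?T \<subseteq> incident ?K v" using v d(2) by (simp add: incident_def)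
      have cT: "card ?T = 3" using ne d(3) by simp
      have "?N \<subseteq> {E. E \<subseteq> incident ?K v \<and> card E = 3 \<and> card (E \<inter> ?T) \<ge> 2}"
      proof
        fix E assume E: "E \<in> ?N"
        then obtain e f where ef: "e \<in> E" "f \<in> E" "e \<noteq> f"
          "{e, f} = {d, m} \<or> {e, f} = {d', m'} \<or> {e, f} = {d, d'}"
          using bad[of E] by auto
        have efT: "{e, f} \<subseteq> ?T" using ef(4) unfolding mm by (elim disjE; simp only:; blast)
        have "E \<in> star_sets ?K 3" using E by simp
        then obtain w where w: "E \<subseteq> incident ?K w" "card E = 3"
          unfolding star_sets_eq_UN[OF K zero_less_numeral] by auto
        \<comment> \<open>The star \<open>E\<close> shares the two edges \<open>e\<close> and
          \<open>f\<close> with \<open>?T\<close>, so both have the same centre.\<close>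
        have "w = v"
          using simple_two_common[OF K, of e f w v] w ef efT T by (auto simp: incident_def)
        moreover have "card {e, f} \<le> card (E \<inter> ?T)" using ef efT by (intro card_mono) auto
        ultimately show "E \<in> {E. E \<subseteq> incident ?K v \<and> card E = 3 \<and> card (E \<inter> ?T) \<ge> 2}"
          using w ef by simp
      qed
      then have "card ?N \<le> card {E. E \<subseteq> incident ?K v \<and> card E = 3 \<and> card (E \<inter> ?T) \<ge> 2}"
        by (intro card_mono) (auto simp: incident_def)
      also have "\<dots> = 3 * (n - 3) + 1"
        using card_triples_meeting_triple[OF _ T cT] card_incident[OF vK] by (simp add: incident_def)
      finally show ?thesis .
    qed
  qed
qed

text \<open>Three edges \<open>T\<close> at one vertex receive a common colour and all other edges
  get colours of their own, which uses \<open>n\<^sup>2 - 3 + 1\<close> colours.\<close>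

lemma ex_coloring_max_nonrainbow:
  assumes n: "n \<ge> 4"
  obtains c where "exact_edge_coloring (n\<^sup>2 - 2) (complete_bipartite n n) c"
    "card {E \<in> star_sets (complete_bipartite n n) 3. \<not> inj_on c E} = 3 * (n - 3) + 1"
proof -
  let ?K = "complete_bipartite n n"
  have n0: "n > 0" using n by simp
  have K: "simple_graph ?K" using n0 by (rule simple_complete_bipartite)
  let ?v = "Inl 0 :: nat + nat"
  have vK: "?v \<in> verts ?K" using n by (auto simp: complete_bipartite_def)
  have fin: "finite (incident ?K ?v)" by (simp add: incident_def)
  obtain T where T: "T \<subseteq> incident ?K ?v" "card T = 3"
    using obtain_subset_with_card_n[of 3 "incident ?K ?v"] card_incident[OF vK] n by auto
  have TK: "T \<subseteq> edges ?K" using T by (auto simp: incident_def)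
  have fT: "finite T" using T fin finite_subset by blast
  obtain a where a: "a \<in> T" using T by fastforce
  \<comment> \<open>One edge per colour class: \<open>a\<close> represents \<open>T\<close>, so a
    bijection from \<open>?R\<close> to the colours determines the colouring.\<close>
  let ?R = "insert a (edges ?K - T)"
  have "card ?R = Suc (n\<^sup>2 - 3)"
    using a T TK fT by (simp add: card_Diff_subset card_edges_complete_bipartite)
  also have "\<dots> = n\<^sup>2 - 2"
    using n mult_le_mono[OF n n] by (simp add: power2_eq_square)
  finally have "card ?R = card {1..n\<^sup>2 - 2}" by simp
  then obtain g where g: "bij_betw g ?R {1..n\<^sup>2 - 2}"
    using finite_same_card_bij[of ?R "{1..n\<^sup>2 - 2}"] by auto
  define c where "c = (\<lambda>e. if e \<in> T then g a else g e)"
  have "c ` edges ?K = g ` ?R"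
    using a TK by (auto simp: c_def image_iff)
  then have c: "exact_edge_coloring (n\<^sup>2 - 2) ?K c"
    using g by (simp add: exact_edge_coloring_def bij_betw_def)
  \<comment> \<open>This inclusion is enough, since the reverse inequality is
    \<open>card_nonrainbow_le\<close>.\<close>
  have "{E. E \<subseteq> incident ?K ?v \<and> card E = 3 \<and> card (E \<inter> T) \<ge> 2}
      \<subseteq> {E \<in> star_sets ?K 3. \<not> inj_on c E}"
  proof
    fix E assume "E \<in> {E. E \<subseteq> incident ?K ?v \<and> card E = 3 \<and> card (E \<inter> T) \<ge> 2}"
    then have E: "E \<subseteq> incident ?K ?v" "card E = 3" "card (E \<inter> T) \<ge> 2" by auto
    obtain e f where "e \<in> E \<inter> T" "f \<in> E \<inter> T" "e \<noteq> f"
      using E(3) by (meson card_2_iff' obtain_subset_with_card_n subsetD)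
    then have "\<not> inj_on c E" by (auto simp: inj_on_def c_def)
    moreover have "E \<in> star_sets ?K 3"
      using E vK unfolding star_sets_eq_UN[OF K zero_less_numeral] by blast
    ultimately show "E \<in> {E \<in> star_sets ?K 3. \<not> inj_on c E}" by simp
  qed
  then have "card {E. E \<subseteq> incident ?K ?v \<and> card E = 3 \<and> card (E \<inter> T) \<ge> 2}
      \<le> card {E \<in> star_sets ?K 3. \<not> inj_on c E}"
    by (intro card_mono) auto
  then have "3 * (n - 3) + 1 \<le> card {E \<in> star_sets ?K 3. \<not> inj_on c E}"
    using card_triples_meeting_triple[OF fin T] card_incident[OF vK] by simp
  then show thesis
    by (intro that[OF c] antisym card_nonrainbow_le[OF n c])
qed

section \<open>Many colours, at most two at each vertex: a large monochromatic star\<close>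

text \<open>A set avoiding \<open>x\<close> would have to contain all of \<open>P\<close>. In the
  application \<open>S\<close> is the colour set of a row and the pairs are colour sets of columns,
  or the other way round.\<close>

lemma mem_if_meets_three_pairs:
  assumes "card S \<le> 2" "finite S" "card P \<ge> 3" "\<And>p. p \<in> P \<Longrightarrow> S \<inter> {x, p} \<noteq> {}"
  shows "x \<in> S"
proof (rule ccontr)
  assume "x \<notin> S"
  then have "P \<subseteq> S" using assms(4) by blast
  then show False using assms card_mono[of S P] by linarith
qed

text \<open>With at least seven colours and at most two of them in each row and column, cross-intersection
  of the colour sets of rows and columns forces a colour \<open>x\<close> common to all rows and columns.
  Each further colour then lives in its own block, off which the rows of the block are constantly \<open>x\<close>.\<close>

lemma locally_two_coloured_matrix:
  fixes f :: "nat \<Rightarrow> nat \<Rightarrow> 'c"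
  assumes row: "\<And>i. i < m \<Longrightarrow> card (f i ` {..<m}) \<le> 2"
    and col: "\<And>j. j < m \<Longrightarrow> card ((\<lambda>i. f i j) ` {..<m}) \<le> 2"
    and q: "card ((\<lambda>(i, j). f i j) ` ({..<m} \<times> {..<m})) = q" "q \<ge> 7" "2 * h \<le> q"
  shows "\<exists>i<m. \<exists>z. card {j. j < m \<and> f i j = z} \<ge> h"
proof (rule ccontr)
  assume "\<not> ?thesis"
  then have few: "card {j. j < m \<and> f i j = z} < h" if "i < m" for i z
    using that by (meson not_le)
  define L where "L = (\<lambda>i. f i ` {..<m})"
  define R where "R = (\<lambda>j. (\<lambda>i. f i j) ` {..<m})"
  define C where "C = (\<lambda>(i, j). f i j) ` ({..<m} \<times> {..<m})"
  have finC: "finite C" by (simp add: C_def)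
  have cC: "card C = q" using q by (simp add: C_def)
  have fL [simp]: "finite (L i)" and fR [simp]: "finite (R j)" for i j by (auto simp: L_def R_def)
  have cL: "card (L i) \<le> 2" if "i < m" for i using row that by (simp add: L_def)
  have cR: "card (R j) \<le> 2" if "j < m" for j using col that by (simp add: R_def)
  \<comment> \<open>The entry \<open>f i j\<close> witnesses that the colour sets of row
    \<open>i\<close> and column \<open>j\<close> intersect.\<close>
  have mL: "f i j \<in> L i" "f i j \<in> R j" if "i < m" "j < m" for i j using that by (auto simp: L_def R_def)
  have CL: "\<exists>i<m. c \<in> L i" and CR: "\<exists>j<m. c \<in> R j" if "c \<in> C" for c
    using that by (auto simp: C_def L_def R_def)
  have two: "S = {x, y}" if "card S \<le> 2" "finite S" "x \<in> S" "y \<in> S" "x \<noteq> y" for S :: "'c set" and x y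
    using that by (metis card_2_iff card_seteq empty_subsetI insert_subset)
  \<comment> \<open>If \<open>x\<close> shares columns with three other colours \<open>p\<close>,
    those columns have colour sets \<open>{x, p}\<close>, and every row must meet all of
    them.\<close>
  have step: "x \<in> L i" if "card {c \<in> C - {x}. \<exists>j<m. x \<in> R j \<and> c \<in> R j} \<ge> 3" "i < m" for x i
  proof (rule mem_if_meets_three_pairs[OF cL[OF that(2)] fL that(1)])
    fix p assume "p \<in> {c \<in> C - {x}. \<exists>j<m. x \<in> R j \<and> c \<in> R j}"
    then obtain j where j: "j < m" "x \<in> R j" "p \<in> R j" "x \<noteq> p" by auto
    then have "R j = {x, p}" using two cR by simp
    then show "L i \<inter> {x, p} \<noteq> {}" using mL[OF that(2) j(1)] by blast
  qed
  have step': "x \<in> R j" if "card {c \<in> C - {x}. \<exists>i<m. x \<in> L i \<and> c \<in> L i} \<ge> 3" "j < m" for x j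
  proof (rule mem_if_meets_three_pairs[OF cR[OF that(2)] fR that(1)])
    fix p assume "p \<in> {c \<in> C - {x}. \<exists>i<m. x \<in> L i \<and> c \<in> L i}"
    then obtain i where i: "i < m" "x \<in> L i" "p \<in> L i" "x \<noteq> p" by auto
    then have "L i = {x, p}" using two cL by simp
    then show "R j \<inter> {x, p} \<noteq> {}" using mL[OF i(1) that(2)] by blast
  qed
  have m0: "m > 0" using q by (cases m) auto
  obtain x where xL: "\<And>i. i < m \<Longrightarrow> x \<in> L i"
  proof -
    obtain x y where xy: "L 0 \<subseteq> {x, y}"
    proof (cases "\<exists>x y. x \<in> L 0 \<and> y \<in> L 0 \<and> x \<noteq> y")
      case True
      then show ?thesis using two[OF cL[OF m0] fL] that by (metis order_refl)
    next
      case False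
      then show ?thesis using that by blast
    qed
    \<comment> \<open>Every column meets row 0, so each of the at least \<open>q - 2 \<ge> 5\<close>
      other colours shares a column with \<open>x\<close> or \<open>y\<close>. One of the two thus
      has three partners, which is where seven colours are needed.\<close>
    let ?P = "\<lambda>x. {c \<in> C - {x}. \<exists>j<m. x \<in> R j \<and> c \<in> R j}"
    have "C - {x, y} \<subseteq> ?P x \<union> ?P y"
    proof
      fix c assume c: "c \<in> C - {x, y}"
      then obtain j where j: "j < m" "c \<in> R j" using CR by blast
      have "f 0 j \<in> {x, y}" "f 0 j \<in> R j" using mL[OF m0 j(1)] xy by auto
      then show "c \<in> ?P x \<union> ?P y" using c j by auto
    qed
    then have "card (C - {x, y}) \<le> card (?P x \<union> ?P y)" using finC by (intro card_mono) auto
    also have "\<dots> \<le> card (?P x) + card (?P y)" by (rule card_Un_le)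
    finally have "card (C - {x, y}) \<le> card (?P x) + card (?P y)" .
    moreover have "card (C - {x, y}) \<ge> card C - card {x, y}" by (intro diff_card_le_card_Diff) simp
    moreover have "card {x, y} \<le> 2" by (simp add: card_insert_if)
    ultimately have "card (?P x) \<ge> 3 \<or> card (?P y) \<ge> 3" using cC q(2) by linarith
    then show thesis using step that by blast
  qed
  have cCx: "card (C - {x}) \<ge> q - 1"
    using diff_card_le_card_Diff[of "{x}" C] cC by simp
  \<comment> \<open>Since \<open>x\<close> occurs in every row, all other colours are its partners
    in rows, and \<open>step'\<close> carries \<open>x\<close> over to the columns.\<close>
  have "{c \<in> C - {x}. \<exists>i<m. x \<in> L i \<and> c \<in> L i} = C - {x}" using CL xL by blast
  then have xR: "x \<in> R j" if "j < m" for j using step' that cCx q(2) by simp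
  define B where "B = (\<lambda>c. {j. j < m \<and> c \<in> R j})"
  have fB: "finite (B c)" for c by (simp add: B_def)
  \<comment> \<open>Each column shows \<open>x\<close> and has room for only one further
    colour.\<close>
  have disj: "B a \<inter> B b = {}" if "a \<noteq> b" "a \<noteq> x" "b \<noteq> x" for a b
  proof (rule ccontr)
    assume "\<not> ?thesis"
    then obtain j where "j < m" "a \<in> R j" "b \<in> R j" by (auto simp: B_def)
    then have "R j = {x, a}" "R j = {x, b}" using two[OF cR fR xR] that by metis+
    then show False using that by (auto simp: doubleton_eq_iff)
  qed
  \<comment> \<open>A row showing \<open>a\<close> has only the colours \<open>x\<close> and
    \<open>a\<close>; as \<open>x\<close> fills fewer than \<open>h\<close> of its entries,
    \<open>a\<close> occurs in more than \<open>m - h\<close> columns.\<close>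
  have big: "m < h + card (B a)" if a: "a \<in> C" "a \<noteq> x" for a
  proof -
    obtain i where i: "i < m" "a \<in> L i" using CL a by blast
    have Li: "L i = {x, a}" using two[OF cL[OF i(1)] fL xL[OF i(1)] i(2)] a by simp
    have "{..<m} \<subseteq> {j. j < m \<and> f i j = x} \<union> B a"
      using mL[OF i(1)] Li by (fastforce simp: B_def)
    then have "card {..<m} \<le> card ({j. j < m \<and> f i j = x} \<union> B a)" using fB by (intro card_mono) auto
    also have "\<dots> \<le> card {j. j < m \<and> f i j = x} + card (B a)" by (rule card_Un_le)
    finally show ?thesis using few[OF i(1), of x] by simp
  qed
  \<comment> \<open>Different colours other than \<open>x\<close> occupy different columns.\<close>
  have "q - 1 \<le> m"
  proof -
    have "\<forall>c\<in>C - {x}. \<exists>j<m. c \<in> R j" using CR by blast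
    then obtain r where r: "\<And>c. c \<in> C - {x} \<Longrightarrow> r c < m \<and> c \<in> R (r c)" by metis
    have "inj_on r (C - {x})"
    proof (rule inj_onI)
      fix a b assume "a \<in> C - {x}" "b \<in> C - {x}" "r a = r b"
      then have "r a \<in> B a \<inter> B b" "a \<noteq> x" "b \<noteq> x" using r[of a] r[of b] by (auto simp: B_def)
      then show "a = b" using disj by blast
    qed
    then have "card (C - {x}) \<le> card {..<m}"
      using r by (intro card_inj_on_le) auto
    then show ?thesis using cCx by simp
  qed
  \<comment> \<open>Two disjoint blocks of columns, each of size at least \<open>m - h + 1\<close>,
    fit into \<open>m\<close> columns. Together with \<open>2 * h \<le> q \<le> m + 1\<close> this
    is absurd.\<close>
  moreover have "m + 2 \<le> 2 * h"
  proof -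
    have "card (C - {x}) \<ge> 2" using cCx q(2) by linarith
    then obtain a b where ab: "a \<in> C - {x}" "b \<in> C - {x}" "a \<noteq> b"
      by (meson card_2_iff' obtain_subset_with_card_n subsetD)
    have "card (B a \<union> B b) = card (B a) + card (B b)"
      using disj ab fB by (intro card_Un_disjoint) auto
    moreover have "card (B a \<union> B b) \<le> card {..<m}" by (intro card_mono) (auto simp: B_def)
    ultimately show ?thesis using big[of a] big[of b] ab by simp
  qed
  ultimately show False using q by linarith
qed

text \<open>Without rainbow stars the matrix of edge colours has at most two colours per row and
  column; \<open>h\<close> equal entries in a row are a monochromatic star centred at the vertex of
  that row.\<close>

lemma rainbow_or_mono_star_set:
  assumes c: "exact_edge_coloring q (complete_bipartite m m) c" and q: "q \<ge> 7" "2 * h \<le> q"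
  shows "(\<exists>E\<in>star_sets (complete_bipartite m m) 3. inj_on c E) \<or>
    (\<exists>E\<in>star_sets (complete_bipartite m m) h. \<forall>e\<in>E. \<forall>e'\<in>E. c e = c e')"
proof (rule ccontr)
  let ?K = "complete_bipartite m m"
  assume none: "\<not> ?thesis"
  have nr: "\<not> inj_on c E" if "E \<in> star_sets ?K 3" for E
    using none that by blast
  have nm: "\<not> (\<forall>e\<in>E. \<forall>e'\<in>E. c e = c e')" if "E \<in> star_sets ?K h" for E
    using none that by blast
  have inc: "card (c ` incident ?K v) \<le> 2" for v
  proof (rule ccontr)
    assume "\<not> ?thesis"
    then have "3 \<le> card (c ` incident ?K v)" by simp
    then obtain Y where Y: "Y \<subseteq> c ` incident ?K v" "card Y = 3"
      using obtain_subset_with_card_n by metis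
    \<comment> \<open>Three colours at \<open>v\<close> would give a rainbow star by picking one
      edge of each.\<close>
    then obtain E where E: "E \<subseteq> incident ?K v" "inj_on c E" "Y = c ` E"
      using subset_image_inj[of Y c "incident ?K v"] by auto
    then have "card E = 3" using Y by (simp add: card_image)
    then have "E \<in> star_sets ?K 3" using E by (auto simp: star_sets_def incident_def)
    then show False using nr E by blast
  qed
  define f where "f = (\<lambda>i j. c {Inl i, Inr j})"
  have "\<exists>i<m. \<exists>z. card {j. j < m \<and> f i j = z} \<ge> h"
  proof (rule locally_two_coloured_matrix[OF _ _ _ q])
    show "card (f i ` {..<m}) \<le> 2" if "i < m" for i
      using inc[of "Inl i"] that by (simp add: incident_Inl f_def image_image)
    show "card ((\<lambda>i. f i j) ` {..<m}) \<le> 2" if "j < m" for j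
      using inc[of "Inr j"] that by (simp add: incident_Inr f_def image_image)
    have "(\<lambda>(i, j). f i j) ` ({..<m} \<times> {..<m}) = c ` edges ?K"
      by (simp add: edges_complete_bipartite f_def image_image case_prod_beta)
    then show "card ((\<lambda>(i, j). f i j) ` ({..<m} \<times> {..<m})) = q"
      using c by (simp add: exact_edge_coloring_def)
  qed
  then obtain i z where i: "i < m" "card {j. j < m \<and> f i j = z} \<ge> h" by blast
  then obtain J where J: "J \<subseteq> {j. j < m \<and> f i j = z}" "card J = h"
    using obtain_subset_with_card_n by metis
  let ?E = "(\<lambda>j. {Inl i, Inr j}) ` J"
  have "inj_on (\<lambda>j. {Inl i, Inr j}) J" by (auto simp: inj_on_def doubleton_eq_iff)
  then have "card ?E = h" using J by (simp add: card_image)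
  moreover have "?E \<subseteq> edges ?K" using J i by (auto simp: edges_complete_bipartite)
  ultimately have "?E \<in> star_sets ?K h" by (auto simp: star_sets_def)
  moreover have "\<forall>e\<in>?E. \<forall>e'\<in>?E. c e = c e'" using J by (auto simp: f_def)
  ultimately show False using nm by blast
qed

section \<open>The Gallai-Ramsey number and the multiplicity\<close>

text \<open>Vandermonde's identity for splitting off three elements. With \<open>m = t - 3\<close>
  the last two terms are the maximal number of spoiled stars, which yields the closed form of the
  theorem.\<close>

lemma choose_3_expand:
  "((m + 3) choose 3) = (m choose 3) + 3 * (m choose 2) + 3 * m + 1"
  by (simp add: numeral_3_eq_3 numeral_2_eq_2)

text \<open>The upper bound is \<open>rainbow_or_mono_star_set\<close> with
  \<open>t\<^sup>2 - 2\<close> colours. The lower bound is purely a matter of size: for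
  \<open>N < t\<close> there are at most \<open>(t - 1)\<^sup>2 < t\<^sup>2 - 2\<close> edges, too
  few for an exact colouring.\<close>

lemma bgr_K13_star:
  fixes x :: 'a
  assumes t: "t \<ge> 4" and A: "finite A" "A \<noteq> {}" "x \<notin> A" and h: "2 * card A \<le> t\<^sup>2 - 2"
  shows "bgr (t\<^sup>2 - 2) (complete_bipartite 1 3) (star x A) = t"
proof -
  have tt: "t\<^sup>2 \<ge> 4 * t" using t by (simp add: power2_eq_square)
  show ?thesis
    unfolding bgr_def
  proof (rule Least_equality, intro conjI allI impI)
    show "\<exists>c. exact_edge_coloring (t\<^sup>2 - 2) (complete_bipartite t t) c"
      using ex_coloring_max_nonrainbow[OF t] by blast
    fix m c assume m: "t \<le> m" and c: "exact_edge_coloring (t\<^sup>2 - 2) (complete_bipartite m m) c"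
    let ?K = "complete_bipartite m m"
    have K: "simple_graph ?K" using m t by (intro simple_complete_bipartite) simp
    have 3: "edges ` copies (complete_bipartite 1 3) ?K = star_sets ?K 3"
      using bij_betw_copies_K13[OF K] by (simp add: bij_betw_def)
    have H: "edges ` copies (star x A) ?K = star_sets ?K (card A)"
      using bij_betw_copies_star[OF K A] by (simp add: bij_betw_def)
    have "t\<^sup>2 - 2 \<ge> 7" using t tt by linarith
    from rainbow_or_mono_star_set[OF c this h]
    show "(\<exists>C\<in>copies (complete_bipartite 1 3) ?K. rainbow c C) \<or>
        (\<exists>C\<in>copies (star x A) ?K. monochromatic c C)"
      unfolding 3[symmetric] H[symmetric] by (simp add: rainbow_def monochromatic_def)
  next
    fix N assume "(\<exists>c. exact_edge_coloring (t\<^sup>2 - 2) (complete_bipartite N N) c) \<and>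
     (\<forall>n\<ge>N. \<forall>c. exact_edge_coloring (t\<^sup>2 - 2) (complete_bipartite n n) c \<longrightarrow>
        (\<exists>C\<in>copies (complete_bipartite 1 3) (complete_bipartite n n). rainbow c C) \<or>
        (\<exists>C\<in>copies (star x A) (complete_bipartite n n). monochromatic c C))"
    then obtain c where "exact_edge_coloring (t\<^sup>2 - 2) (complete_bipartite N N) c" by blast
    then have "t\<^sup>2 - 2 \<le> N\<^sup>2"
      using card_image_le[OF finite_edges_complete_bipartite, of c N]
      by (simp add: exact_edge_coloring_def card_edges_complete_bipartite)
    show "t \<le> N"
    proof (rule ccontr)
      assume "\<not> t \<le> N"
      then obtain s where s: "t = Suc s" "N \<le> s" by (cases t) auto
      then have "N\<^sup>2 \<le> s\<^sup>2" by simp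
      moreover have "t\<^sup>2 = s\<^sup>2 + 2 * s + 1" using s by (simp add: power2_eq_square)
      ultimately show False using \<open>t\<^sup>2 - 2 \<le> N\<^sup>2\<close> s t by linarith
    qed
  qed
qed

text \<open>Four edges of one colour would leave at most \<open>n\<^sup>2 - 4\<close> edges for the
  other colours, hence at most \<open>n\<^sup>2 - 3\<close> colours in total.\<close>

lemma no_monochromatic_copy:
  assumes n: "n \<ge> 4" and c: "exact_edge_coloring (n\<^sup>2 - 2) (complete_bipartite n n) c"
    and E: "E \<subseteq> edges (complete_bipartite n n)" "card E \<ge> 4"
  shows "\<not> (\<forall>e\<in>E. \<forall>e'\<in>E. c e = c e')"
proof
  let ?X = "edges (complete_bipartite n n)"
  assume mono: "\<forall>e\<in>E. \<forall>e'\<in>E. c e = c e'"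
  have fE: "finite E" using E(1) by (rule finite_subset) simp
  obtain a where a: "a \<in> E" using E by fastforce
  have "c ` ?X \<subseteq> insert (c a) (c ` (?X - E))" using mono a by blast
  then have "card (c ` ?X) \<le> card (insert (c a) (c ` (?X - E)))"
    by (rule card_mono[rotated]) simp
  also have "\<dots> \<le> Suc (card (c ` (?X - E)))" by (rule card_insert_le_m1) auto
  also have "\<dots> \<le> Suc (card (?X - E))" by (simp add: card_image_le)
  also have "\<dots> = Suc (n\<^sup>2 - card E)"
    using E fE by (simp add: card_Diff_subset card_edges_complete_bipartite)
  finally have "n\<^sup>2 - 2 \<le> Suc (n\<^sup>2 - card E)" using c by (simp add: exact_edge_coloring_def)
  moreover have "n\<^sup>2 \<ge> 4 * n" using n by (simp add: power2_eq_square)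
  ultimately show False using n E(2) by linarith
qed

text \<open>Monochromatic copies do not occur, so the minimum is the number of all three-edge stars
  minus the largest possible number of non-rainbow ones.\<close>

lemma bi_GM_K13_star:
  fixes x :: 'a
  assumes t: "t \<ge> 4" and A: "finite A" "x \<notin> A" "card A \<ge> 4" and h: "2 * card A \<le> t\<^sup>2 - 2"
  shows "bi_GM (t\<^sup>2 - 2) (complete_bipartite 1 3) (star x A) =
    2 * t * (t choose 3) - (3 * (t - 3) + 1)"
proof -
  let ?K = "complete_bipartite t t"
  let ?S = "star_sets ?K 3"
  have A': "A \<noteq> {}" using A by auto
  have K: "simple_graph ?K" using t by (intro simple_complete_bipartite) simp
  have 3: "bij_betw edges (copies (complete_bipartite 1 3) ?K) ?S"
    using K by (rule bij_betw_copies_K13)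
  have H: "edges ` copies (star x A) ?K = star_sets ?K (card A)"
    using bij_betw_copies_star[OF K A(1) A' A(2)] by (simp add: bij_betw_def)
  have count: "card {C \<in> copies (complete_bipartite 1 3) ?K. rainbow c C} +
      card {C \<in> copies (star x A) ?K. monochromatic c C}
      = 2 * t * (t choose 3) - card {E \<in> ?S. \<not> inj_on c E}"
    if c: "exact_edge_coloring (t\<^sup>2 - 2) ?K c" for c
  proof -
    have "\<not> monochromatic c C" if "C \<in> copies (star x A) ?K" for C
    proof -
      have "edges C \<in> star_sets ?K (card A)" using that H by blast
      then show ?thesis
        using no_monochromatic_copy[OF t c, of "edges C"] A
        by (auto simp: star_sets_def monochromatic_def)
    qed
    then have mono: "{C \<in> copies (star x A) ?K. monochromatic c C} = {}" by blast
    have "bij_betw edges {C \<in> copies (complete_bipartite 1 3) ?K. rainbow c C} {E \<in> ?S. inj_on c E}"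
    proof (rule bij_betw_subset[OF 3])
      have "?S = edges ` copies (complete_bipartite 1 3) ?K" using 3 by (simp add: bij_betw_def)
      then show "edges ` {C \<in> copies (complete_bipartite 1 3) ?K. rainbow c C} = {E \<in> ?S. inj_on c E}"
        unfolding rainbow_def by (simp only:) blast
    qed blast
    then have "card {C \<in> copies (complete_bipartite 1 3) ?K. rainbow c C} = card {E \<in> ?S. inj_on c E}"
      by (rule bij_betw_same_card)
    also have "{E \<in> ?S. inj_on c E} = ?S - {E \<in> ?S. \<not> inj_on c E}" by blast
    also have "card \<dots> = card ?S - card {E \<in> ?S. \<not> inj_on c E}" by (intro card_Diff_subset) auto
    finally show ?thesis unfolding mono using t by (simp add: card_star_sets)
  qed
  obtain c0 where c0: "exact_edge_coloring (t\<^sup>2 - 2) ?K c0"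
    "card {E \<in> ?S. \<not> inj_on c0 E} = 3 * (t - 3) + 1"
    using ex_coloring_max_nonrainbow[OF t] by blast
  show ?thesis
    unfolding bi_GM_def bgr_K13_star[OF t A(1) A' A(2) h] Let_def
  proof (rule Least_equality)
    show "\<exists>c. exact_edge_coloring (t\<^sup>2 - 2) ?K c \<and>
        2 * t * (t choose 3) - (3 * (t - 3) + 1) =
        card {C \<in> copies (complete_bipartite 1 3) ?K. rainbow c C} +
        card {C \<in> copies (star x A) ?K. monochromatic c C}"
      using c0 count by (intro exI[of _ c0]) simp
    fix m assume "\<exists>c. exact_edge_coloring (t\<^sup>2 - 2) ?K c \<and>
        m = card {C \<in> copies (complete_bipartite 1 3) ?K. rainbow c C} +
        card {C \<in> copies (star x A) ?K. monochromatic c C}"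
    then obtain c where c: "exact_edge_coloring (t\<^sup>2 - 2) ?K c"
      "m = 2 * t * (t choose 3) - card {E \<in> ?S. \<not> inj_on c E}" using count by auto
    show "2 * t * (t choose 3) - (3 * (t - 3) + 1) \<le> m"
      unfolding c(2) using card_nonrainbow_le[OF t c(1)] by (rule diff_le_mono2)
  qed
qed

theorem theorem4p8:
  fixes k t :: nat and H :: "'a graph"
  assumes "k = t ^ 2" and "k \<ge> 9"
    and "simple_graph H"
    and "\<exists>S. subgraph S (complete_bipartite 1 (nat \<lceil>(real k - 3) / 2\<rceil>)) \<and> isomorphic H S"
    and "card (edges H) \<ge> 4"
  shows "bi_GM (k - 2) (complete_bipartite 1 3) H =
    (if t = 3 then 4
     else if t = 4 then 28
     else if t = 5 then 93
     else (2 * t - 1) * (t choose 3) + ((t - 3) choose 3) + 3 * ((t - 3) choose 2))"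
proof -
  have "edges H \<noteq> {}" using assms(5) by auto
  then obtain x A where HA: "H = star x A" and A: "finite A" "x \<notin> A"
    and le: "card A \<le> nat \<lceil>(real k - 3) / 2\<rceil>"
    using subgraph_of_star_is_star assms(3,4) by metis
  have cA: "card A \<ge> 4" using assms(5) HA by simp
  have h: "2 * card A \<le> k - 2"
  proof -
    \<comment> \<open>Doubling gives a value strictly below \<open>k - 1\<close>, and being an
      integer it is at most \<open>k - 2\<close>, for either parity of \<open>k\<close>.\<close>
    have "real_of_int \<lceil>(real k - 3) / 2\<rceil> < (real k - 3) / 2 + 1"
      using ceiling_correct[of "(real k - 3) / 2"] by linarith
    then have "real_of_int (2 * \<lceil>(real k - 3) / 2\<rceil>) < real_of_int (int k - 1)"
      by (simp add: field_simps)
    then have "2 * \<lceil>(real k - 3) / 2\<rceil> < int k - 1" by (simp only: of_int_less_iff)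
    then show ?thesis using le assms(2) by linarith
  qed
  text \<open>In particular \<open>t = 3\<close> is impossible: \<open>H\<close> would have at most three edges.\<close>
  have t: "t \<ge> 4"
  proof (rule ccontr)
    assume "\<not> t \<ge> 4"
    then have "t\<^sup>2 \<le> 3\<^sup>2" by (intro power_mono) auto
    then show False using h cA assms(1) by simp
  qed
  define m where "m = t - 3"
  have m: "t = m + 3" using t by (simp add: m_def)
  have "bi_GM (k - 2) (complete_bipartite 1 3) H = 2 * t * (t choose 3) - (3 * (t - 3) + 1)"
    using bi_GM_K13_star[OF t A cA] h HA assms(1) by simp
  \<comment> \<open>The subtraction is confined to one of the \<open>2 * t\<close> summands, which
    is large enough for it not to be truncated.\<close>
  also have "\<dots> = (2 * t - 1) * (t choose 3) + ((t choose 3) - (3 * (t - 3) + 1))"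
  proof -
    have "2 * t * (t choose 3) = (2 * t - 1) * (t choose 3) + (t choose 3)"
      using t by (simp add: algebra_simps diff_mult_distrib)
    moreover have "3 * (t - 3) + 1 \<le> (t choose 3)" using choose_3_expand[of m] m by simp
    ultimately show ?thesis by linarith
  qed
  also have "(t choose 3) - (3 * (t - 3) + 1) = ((t - 3) choose 3) + 3 * ((t - 3) choose 2)"
    using choose_3_expand[of m] m by simp
  finally have "bi_GM (k - 2) (complete_bipartite 1 3) H =
      (2 * t - 1) * (t choose 3) + ((t - 3) choose 3) + 3 * ((t - 3) choose 2)" by simp
  moreover have "t \<noteq> 3" using t by simp
  \<comment> \<open>The values 28 and 93 are those of the general formula at \<open>t = 4\<close>
    and \<open>t = 5\<close>.\<close>
  ultimately show ?thesis by (auto simp: numeral_eq_Suc)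
qed

end
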